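(* Let $\mathbb{L}$ be a Dedekind-complete unital $f$-algebra over $\mathbb{R}$. Let $X$ and $Y$ be directed partially ordered $\mathbb{L}$-modules with $Y$ sequentially almost Archimedean, and let $T:X^+\to Y^+$ be an additive $\mathbb{P}$-homogeneous function (i.e. $T(x+y)=T(x)+T(y)$ and $T(\pi x)=\pi T(x)$ for all $x,y\in X^+$ and all $\pi\in\mathbb{P}$). Then $T$ extends uniquely to a positive operator $\widehat{T}:X\to Y$.
   Context: $\mathbb{L}$ is a real Dedekind-complete unital $f$-algebra with multiplicative unit $1$. $\mathbb{P}=\{\pi\in\mathbb{L}:\pi^2=\pi\}$ is the set of idempotents of $\mathbb{L}$. A partially ordered (PO) $\mathbb{L}$-module is an $\mathbb{L}$-module $X$ with a partial order such that $x\le y$ implies $x+z\le y+z$, and $0\le\lambda$ in $\mathbb{L}$ together with $x\le y$ imply $\lambda x\le\lambda y$. Its positive cone is $X^+=\{x\in X:0\le x\}$. $X$ is directed if every pair of elements of $X$ has an upper bound. A PO $\mathbb{L}$-module $Y$ is sequentially almost Archimedean (that is, sequentially almost $\mathbb{L}$-Archimedean) if for every decreasing sequence $(\lambda_n)$ in $\mathbb{L}$ with infimum $0$, every $x\in Y^+$ and every $y\in Y$: if $-\lambda_n x\le y\le\lambda_n x$ for all $n$, then $y=0$. An operator $X\to Y$ is an $\mathbb{L}$-module homomorphism; it is positive if it maps $X^+$ into $Y^+$. *)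

theory Defs
  imports Complex_Main
begin

text \<open>
  Unital \<open>f\<close>-algebras over the reals. Commutativity is not imposed (it holds automatically
  in the Archimedean case), and neither is \<open>0 \<noteq> 1\<close>, which is why the class is built from
  \<^class>\<open>real_algebra\<close> and \<^class>\<open>monoid_mult\<close> rather than from \<^class>\<open>real_algebra_1\<close>.
\<close>

class f_algebra_1 = real_algebra + monoid_mult + ordered_ring + ordered_real_vector + lattice +
  assumes inf_mult_left_eq_0: "inf a b = 0 \<Longrightarrow> 0 \<le> c \<Longrightarrow> inf (c * a) b = 0"
    and inf_mult_right_eq_0: "inf a b = 0 \<Longrightarrow> 0 \<le> c \<Longrightarrow> inf (a * c) b = 0"

class dedekind_complete_f_algebra_1 = f_algebra_1 + conditionally_complete_lattice

definition idempotents :: "'l::f_algebra_1 set"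
  where "idempotents = {p. p\<^sup>2 = p}"

text \<open>
  The locale \<^locale>\<open>module\<close> of the library needs scalars in \<^class>\<open>comm_ring_1\<close>, hence
  the module axioms are restated here.
\<close>

locale po_module =
  fixes scale :: "'l::f_algebra_1 \<Rightarrow> 'x::ordered_ab_group_add \<Rightarrow> 'x"
  assumes scale_right_distrib: "scale a (x + y) = scale a x + scale a y"
    and scale_left_distrib: "scale (a + b) x = scale a x + scale b x"
    and scale_scale: "scale a (scale b x) = scale (a * b) x"
    and scale_one: "scale 1 x = x"
    and scale_left_mono: "x \<le> y \<Longrightarrow> 0 \<le> a \<Longrightarrow> scale a x \<le> scale a y"

locale directed_po_module = po_module scale
  for scale :: "'l::f_algebra_1 \<Rightarrow> 'x::ordered_ab_group_add \<Rightarrow> 'x" +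
  assumes directed: "\<exists>z. (x :: 'x) \<le> z \<and> y \<le> z"

text \<open>
  \<^term>\<open>Inf (range l)\<close> is only meaningful for a sequence that is bounded below, so boundedness
  is part of the requirement that the infimum be \<open>0\<close>.
\<close>

definition seq_almost_archimedean ::
    "('l::dedekind_complete_f_algebra_1 \<Rightarrow> 'y::ordered_ab_group_add \<Rightarrow> 'y) \<Rightarrow> bool"
  where "seq_almost_archimedean scale \<longleftrightarrow>
    (\<forall>l :: nat \<Rightarrow> 'l. decseq l \<and> bdd_below (range l) \<and> Inf (range l) = 0 \<longrightarrow>
      (\<forall>x\<ge>0. \<forall>y. (\<forall>n. - scale (l n) x \<le> y \<and> y \<le> scale (l n) x) \<longrightarrow> y = 0))"

definition po_module_hom ::
    "('l \<Rightarrow> 'x \<Rightarrow> 'x) \<Rightarrow> ('l \<Rightarrow> 'y \<Rightarrow> 'y) \<Rightarrow>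
      ('x::ordered_ab_group_add \<Rightarrow> 'y::ordered_ab_group_add) \<Rightarrow> bool"
  where "po_module_hom scaleX scaleY S \<longleftrightarrow>
    (\<forall>x y. S (x + y) = S x + S y) \<and> (\<forall>a x. S (scaleX a x) = scaleY a (S x))"

definition positive_operator ::
    "('l \<Rightarrow> 'x \<Rightarrow> 'x) \<Rightarrow> ('l \<Rightarrow> 'y \<Rightarrow> 'y) \<Rightarrow>
      ('x::ordered_ab_group_add \<Rightarrow> 'y::ordered_ab_group_add) \<Rightarrow> bool"
  where "positive_operator scaleX scaleY S \<longleftrightarrow>
    po_module_hom scaleX scaleY S \<and> S ` {0..} \<subseteq> {0..}"

end

theory Submission
  imports Defs "HOL-Library.Lattice_Algebras"
begin

text \<open>
  A positive additive map on \<open>X\<^sup>+\<close> extends to \<open>X = X\<^sup>+ - X\<^sup>+\<close>, so everything rests on showing that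
  the defect \<open>E(\<lambda>) = T(\<lambda>x) - \<lambda>T(x)\<close> vanishes for \<open>\<lambda> \<ge> 0\<close> and \<open>x \<ge> 0\<close>. The defect is additive in
  \<open>\<lambda>\<close> and vanishes on idempotents. If \<open>0 \<le> \<lambda> \<le> 1\<close> and \<open>p\<close> is the idempotent carrying the positive
  part of \<open>2\<lambda> - 1\<close>, then \<open>\<mu> = 2\<lambda> - p\<close> lies in \<open>[0, 1]\<close> again and \<open>E(\<mu>) = 2 E(\<lambda>)\<close>. As \<open>E\<close> is bounded
  by \<open>T(x)\<close> on \<open>[0, 1]\<close>, iteration gives \<open>-T(x) \<le> 2\<^sup>k E(\<lambda>) \<le> T(x)\<close> for all \<open>k\<close>, whence \<open>E(\<lambda>) = 0\<close>.
  Additivity extends this to \<open>\<lambda> \<le> n\<close>. For an arbitrary \<open>\<lambda>\<close> let \<open>p\<close> carry the positive part of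
  \<open>\<lambda> - n\<close>; then \<open>(1 - p)\<lambda> \<le> n\<close> and \<open>np \<le> \<lambda>\<close>, so \<open>E(\<lambda>) = E(p\<lambda>) = p E(\<lambda>)\<close> is bounded by
  \<open>(1/n) \<lambda> (T(\<lambda>x) + \<lambda>T(x))\<close>.
\<close>

instance f_algebra_1 \<subseteq> lattice_ab_group_add ..

section \<open>Unital \<open>f\<close>-algebras\<close>

text \<open>Multiplication by nonnegative elements preserves disjointness: replacing first
  \<open>a\<close> and then \<open>b\<close> by \<open>a * b\<close> makes \<open>a * b\<close>
  disjoint from itself.\<close>

lemma inf_eq_0_mult_eq_0:
  fixes a b :: "'l::f_algebra_1"
  assumes "inf a b = 0"
  shows "a * b = 0"
proof -
  have "0 \<le> a" "0 \<le> b"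
    using assms by (metis inf.cobounded1, metis inf.cobounded2)
  have "inf (a * b) b = 0"
    using inf_mult_right_eq_0[OF assms \<open>0 \<le> b\<close>] .
  then have "inf b (a * b) = 0"
    by (simp add: inf.commute)
  from inf_mult_left_eq_0[OF this \<open>0 \<le> a\<close>] show ?thesis
    by simp
qed

lemma pos_neg_parts:
  fixes a :: "'l::lattice_ab_group_add"
  shows "inf (sup a 0) (sup (- a) 0) = 0" "a = sup a 0 - sup (- a) 0"
proof -
  have eq: "sup a 0 = a + sup (- a) 0"
    by (simp add: add_sup_distrib_left sup.commute)
  then show "a = sup a 0 - sup (- a) 0"
    by (metis add_diff_cancel_right')
  have "inf (a + sup (- a) 0) (0 + sup (- a) 0) = inf a 0 + sup (- a) 0"
    by (rule add_inf_distrib_right[symmetric])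
  moreover have "sup (- a) 0 = - inf a 0"
    by (metis neg_inf_eq_sup minus_zero)
  ultimately show "inf (sup a 0) (sup (- a) 0) = 0"
    by (metis add_0 eq add.right_inverse)
qed

text \<open>The positive and negative parts of \<open>a\<close> are disjoint, so the cross terms of
  the square vanish.\<close>

lemma square_nonneg: "0 \<le> a * (a :: 'l::f_algebra_1)"
proof -
  define u v :: 'l where "u = sup a 0" and "v = sup (- a) 0"
  have "inf u v = 0" and eq: "a = u - v"
    unfolding u_def v_def by (rule pos_neg_parts)+
  then have "u * v = 0" "v * u = 0"
    by (simp_all add: inf_eq_0_mult_eq_0 inf.commute)
  then have "(u - v) * (u - v) = u * u + v * v"
    by (simp add: algebra_simps)
  moreover have "0 \<le> u" "0 \<le> v"
    by (simp_all add: u_def v_def)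
  ultimately show ?thesis
    by (simp add: eq)
qed

text \<open>Not a class axiom; it holds because \<open>1\<close> is its own square.\<close>

lemma one_nonneg: "0 \<le> (1 :: 'l::f_algebra_1)"
  using square_nonneg[of "1 :: 'l"] by simp

text \<open>The infimum minus \<open>y\<close> lies below both \<open>x\<close> and
  \<open>b\<close>, hence below \<open>0\<close>; so the infimum lies below both \<open>y\<close>
  and \<open>b\<close>.\<close>

lemma inf_add_eq_0:
  fixes x y b :: "'l::lattice_ab_group_add"
  assumes "inf x b = 0" "inf y b = 0"
  shows "inf (x + y) b = 0"
proof (rule antisym)
  have nn: "0 \<le> x" "0 \<le> y" "0 \<le> b"
    using assms by (metis inf.cobounded1, metis inf.cobounded1, metis inf.cobounded2)
  then show "0 \<le> inf (x + y) b"
    by simp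
  have "inf (x + y) b - y \<le> x"
    by (simp add: diff_le_eq)
  moreover have "inf (x + y) b - y \<le> b"
    using nn by (meson diff_le_eq inf.coboundedI2 le_add_same_cancel1 order_trans order_refl)
  ultimately have "inf (x + y) b - y \<le> inf x b"
    by simp
  then have "inf (x + y) b \<le> y"
    using assms by simp
  then show "inf (x + y) b \<le> 0"
    using assms(2) by (metis inf.bounded_iff inf.cobounded2)
qed

section \<open>Idempotents and carriers of positive parts\<close>

lemma idempotent_nonneg:
  fixes p :: "'l::f_algebra_1"
  assumes "p \<in> idempotents"
  shows "0 \<le> p"
  using square_nonneg[of p] assms by (simp add: idempotents_def power2_eq_square)

lemma idempotent_compl:
  fixes p :: "'l::f_algebra_1"
  assumes "p \<in> idempotents"
  shows "1 - p \<in> idempotents"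
  using assms by (simp add: idempotents_def power2_eq_square algebra_simps)

lemma idempotent_le_1:
  fixes p :: "'l::f_algebra_1"
  assumes "p \<in> idempotents"
  shows "p \<le> 1"
  using idempotent_nonneg[OF idempotent_compl[OF assms]] by simp

text \<open>
  The idempotent is the largest element of \<open>[0, 1]\<close> disjoint from the negative part of \<open>a\<close>.
\<close>

lemma ex_idempotent_carrier:
  fixes a :: "'l::dedekind_complete_f_algebra_1"
  shows "\<exists>p\<in>idempotents. 0 \<le> p * a \<and> (1 - p) * a \<le> 0"
proof -
  define u v where "u = sup a 0" and "v = sup (- a) 0"
  have uv: "inf u v = 0" and eq: "a = u - v"
    unfolding u_def v_def by (rule pos_neg_parts)+
  have "0 \<le> u" "0 \<le> v"
    by (simp_all add: u_def v_def)
  define D where "D = {x. 0 \<le> x \<and> x \<le> 1 \<and> inf x v = 0}"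
  define p where "p = Sup D"
  have "0 \<in> D"
    using \<open>0 \<le> v\<close> by (simp add: D_def one_nonneg inf_absorb1)
  have bdd: "bdd_above D"
    by (rule bdd_aboveI[of _ 1]) (simp add: D_def)
  have upper: "x \<le> p" if "x \<in> D" for x
    unfolding p_def using that bdd by (rule cSup_upper)
  have "0 \<le> p"
    using upper[OF \<open>0 \<in> D\<close>] .
  have "p \<le> 1"
    unfolding p_def using \<open>0 \<in> D\<close> by (intro cSup_least) (auto simp: D_def)
  have sup_inf: "x + y = sup x y + inf x y" for x y :: 'l
    by (metis add_eq_inf_sup add.commute)
  \<comment> \<open>Disjointness from \<open>v\<close> survives the supremum: for disjoint elements
    sum and join coincide, so \<open>sup p v - v\<close> bounds \<open>D\<close>.\<close>
  have "p \<le> sup p v - v"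
    unfolding p_def
  proof (rule cSup_least)
    fix x assume "x \<in> D"
    then have "x + v = sup x v"
      using sup_inf[of x v] by (simp add: D_def)
    also have "\<dots> \<le> sup p v"
      using upper[OF \<open>x \<in> D\<close>] by (rule sup_mono) simp
    finally show "x \<le> sup (Sup D) v - v"
      by (simp add: p_def le_diff_eq)
  qed (use \<open>0 \<in> D\<close> in blast)
  then have "inf p v \<le> 0"
    using sup_inf[of p v] by (simp add: le_diff_eq)
  then have pv: "inf p v = 0"
    using \<open>0 \<le> p\<close> \<open>0 \<le> v\<close> by (simp add: antisym)
  have sq: "p * p \<le> p"
    using mult_left_mono[OF \<open>p \<le> 1\<close> \<open>0 \<le> p\<close>] by simp
  \<comment> \<open>This element is \<open>1 - (1 - p) * (1 - p)\<close>. As \<open>p\<close> bounds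
    \<open>D\<close>, membership forces \<open>p \<le> p * p\<close>.\<close>
  have "p + p - p * p \<in> D"
  proof -
    have "0 \<le> (1 - p) * (1 - p)"
      using \<open>p \<le> 1\<close> by (intro mult_nonneg_nonneg) simp_all
    then have "p + p - p * p \<le> 1"
      by (simp add: algebra_simps)
    moreover have ge: "0 \<le> p + p - p * p"
      using sq \<open>0 \<le> p\<close> by (metis add_increasing diff_ge_0_iff_ge add_diff_eq)
    moreover have "inf (p + p - p * p) v = 0"
    proof (rule antisym)
      have "p + p - p * p \<le> p + p"
        using \<open>0 \<le> p\<close> by simp
      then show "inf (p + p - p * p) v \<le> 0"
        using inf_add_eq_0[OF pv pv] by (metis inf_mono order_refl)
      show "0 \<le> inf (p + p - p * p) v"
        using ge \<open>0 \<le> v\<close> by simp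
    qed
    ultimately show ?thesis
      by (simp add: D_def)
  qed
  from upper[OF this] have "p \<le> p * p"
    by (simp add: diff_le_eq)
  with sq have pp: "p * p = p"
    by (rule antisym)
  \<comment> \<open>The part of \<open>u\<close> below \<open>1 - p\<close> can be added to
    \<open>p\<close> without leaving \<open>D\<close>, so it is zero.\<close>
  have up: "inf (1 - p) u = 0"
  proof (rule antisym)
    define x where "x = inf (1 - p) u"
    have "0 \<le> x"
      using \<open>p \<le> 1\<close> \<open>0 \<le> u\<close> by (simp add: x_def)
    have "inf x v = 0"
    proof (rule antisym)
      show "inf x v \<le> 0"
        using uv by (metis inf.cobounded2 inf_mono order_refl x_def)
    qed (use \<open>0 \<le> x\<close> \<open>0 \<le> v\<close> in simp)
    moreover have "p + x \<le> 1"
      using inf.cobounded1[of "1 - p" u] by (simp add: x_def[symmetric] le_diff_eq add.commute)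
    ultimately have "p + x \<in> D"
      using \<open>0 \<le> p\<close> \<open>0 \<le> x\<close> pv by (simp add: D_def inf_add_eq_0)
    from upper[OF this] show "inf (1 - p) u \<le> 0"
      by (simp add: x_def)
  qed (use \<open>p \<le> 1\<close> \<open>0 \<le> u\<close> in simp)
  have "p * v = 0" "(1 - p) * u = 0"
    using pv up by (simp_all add: inf_eq_0_mult_eq_0)
  then have "p * a = p * u" "(1 - p) * a = - ((1 - p) * v)"
    by (simp_all add: eq right_diff_distrib)
  then have "0 \<le> p * a" "(1 - p) * a \<le> 0"
    using \<open>0 \<le> p\<close> \<open>p \<le> 1\<close> \<open>0 \<le> u\<close> \<open>0 \<le> v\<close> by simp_all
  then show ?thesis
    using pp by (auto simp: idempotents_def power2_eq_square)
qed

text \<open>Doubling a term gives the preceding one, so twice the infimum is at most the infimum,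
  which is therefore at most \<open>0\<close>.\<close>

lemma Inf_half_powers:
  fixes l :: "nat \<Rightarrow> 'l::dedekind_complete_f_algebra_1"
  defines "l \<equiv> \<lambda>k. (1/2) ^ k *\<^sub>R 1"
  shows "decseq l" "bdd_below (range l)" "Inf (range l) = 0"
proof -
  show "decseq l"
    unfolding l_def decseq_def
    by (auto intro!: scaleR_right_mono power_decreasing one_nonneg)
  have nn: "0 \<le> l k" for k
    unfolding l_def by (intro scaleR_nonneg_nonneg one_nonneg) simp
  then show bdd: "bdd_below (range l)"
    by (intro bdd_belowI[of _ 0]) auto
  have "2 *\<^sub>R Inf (range l) \<le> Inf (range l)"
  proof (rule cInf_greatest)
    fix x assume "x \<in> range l"
    then obtain k where k: "x = l k" by blast
    have "2 *\<^sub>R Inf (range l) \<le> 2 *\<^sub>R l (Suc k)"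
      using bdd by (intro scaleR_left_mono cInf_lower) auto
    also have "\<dots> = x"
      by (simp add: l_def k)
    finally show "2 *\<^sub>R Inf (range l) \<le> x" .
  qed simp
  then have "Inf (range l) \<le> 0"
    by (simp add: scaleR_2)
  moreover have "0 \<le> Inf (range l)"
    using nn by (intro cInf_greatest) auto
  ultimately show "Inf (range l) = 0"
    by (rule antisym)
qed

section \<open>Partially ordered modules\<close>

context po_module
begin

lemma scale_zero_left: "scale 0 x = 0"
  using scale_left_distrib[of 0 0 x] by simp

lemma scale_zero_right: "scale a 0 = 0"
  using scale_right_distrib[of a 0 0] by simp

lemma scale_minus_left: "scale (- a) x = - scale a x"
  using scale_left_distrib[of "- a" a x] by (simp add: scale_zero_left eq_neg_iff_add_eq_0)

lemma scale_minus_right: "scale a (- x) = - scale a x"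
  using scale_right_distrib[of a "- x" x] by (simp add: scale_zero_right eq_neg_iff_add_eq_0)

lemma scale_diff_left: "scale (a - b) x = scale a x - scale b x"
  using scale_left_distrib[of a "- b" x] by (simp add: scale_minus_left)

lemma scale_diff_right: "scale a (x - y) = scale a x - scale a y"
  using scale_right_distrib[of a x "- y"] by (simp add: scale_minus_right)

lemma scale_nonneg: "0 \<le> a \<Longrightarrow> 0 \<le> x \<Longrightarrow> 0 \<le> scale a x"
  using scale_left_mono[of 0 x a] by (simp add: scale_zero_right)

lemma scale_right_mono: "a \<le> b \<Longrightarrow> 0 \<le> x \<Longrightarrow> scale a x \<le> scale b x"
  using scale_nonneg[of "b - a" x] by (simp add: scale_diff_left)

end

text \<open>The form in which the Archimedean hypothesis is applied: a common bound on all multiples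
  of \<open>y\<close> by \<open>2 ^ k\<close> is rescaled by \<open>(1/2) ^ k\<close>.\<close>

lemma seq_almost_archimedean_half_powers:
  fixes scale :: "'l::dedekind_complete_f_algebra_1 \<Rightarrow> 'y::ordered_ab_group_add \<Rightarrow> 'y"
  assumes "po_module scale" "seq_almost_archimedean scale" "0 \<le> x"
    and "\<And>k::nat. - x \<le> scale (2 ^ k *\<^sub>R 1) y" "\<And>k::nat. scale (2 ^ k *\<^sub>R 1) y \<le> x"
  shows "y = 0"
proof -
  interpret po_module scale by fact
  define l :: "nat \<Rightarrow> 'l" where "l = (\<lambda>k. (1/2) ^ k *\<^sub>R 1)"
  have nn: "0 \<le> l k" for k
    unfolding l_def by (intro scaleR_nonneg_nonneg one_nonneg) simp
  have inv: "scale (l k) (scale (2 ^ k *\<^sub>R 1) y) = y" for k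
    by (simp add: scale_scale l_def power_one_over scale_one)
  have "- scale (l k) x \<le> y \<and> y \<le> scale (l k) x" for k
    using scale_left_mono[OF assms(4)[of k] nn[of k]] scale_left_mono[OF assms(5)[of k] nn[of k]]
    by (simp add: inv scale_minus_right)
  moreover have "decseq l" "bdd_below (range l)" "Inf (range l) = 0"
    unfolding l_def by (rule Inf_half_powers)+
  ultimately show ?thesis
    using assms(2,3) unfolding seq_almost_archimedean_def by blast
qed

section \<open>Additive maps on the positive cone\<close>

text \<open>By directedness every element is a difference of positive ones, and additivity makes
  \<open>S (u - v) = T u - T v\<close> well defined.\<close>

lemma additive_cone_extension:
  fixes T :: "'x::ordered_ab_group_add \<Rightarrow> 'y::ab_group_add"
  assumes dir: "\<And>x y :: 'x. \<exists>z. x \<le> z \<and> y \<le> z"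
    and add: "\<And>x y. 0 \<le> x \<Longrightarrow> 0 \<le> y \<Longrightarrow> T (x + y) = T x + T y"
  obtains S where "\<And>x y. S (x + y) = S x + S y" "\<And>x. 0 \<le> x \<Longrightarrow> S x = T x"
proof -
  have split: "\<exists>v\<ge>0. 0 \<le> x + v" for x :: 'x
  proof -
    obtain z where "- x \<le> z" "0 \<le> z"
      using dir by blast
    then show ?thesis
      by (metis add.right_inverse add_left_mono)
  qed
  define f where "f x = (SOME v. 0 \<le> v \<and> 0 \<le> x + v)" for x :: 'x
  have f: "0 \<le> f x" "0 \<le> x + f x" for x
    using someI_ex[of "\<lambda>v. 0 \<le> v \<and> 0 \<le> x + v"] split[of x] by (auto simp: f_def)
  define S where "S x = T (x + f x) - T (f x)" for x
  \<comment> \<open>Any admissible \<open>v\<close> may replace the chosen \<open>f x\<close>;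
    additivity of \<open>S\<close> uses \<open>f x + f y\<close>.\<close>
  have S: "S x = T (x + v) - T v" if "0 \<le> v" "0 \<le> x + v" for x v
  proof -
    have "T (x + f x) + T v = T (x + v) + T (f x)"
      using add[OF f(2)[of x] that(1)] add[OF that(2) f(1)[of x]] by (simp add: ac_simps)
    then show ?thesis
      by (simp add: S_def algebra_simps)
  qed
  show thesis
  proof
    fix x y
    have "S (x + y) = T ((x + f x) + (y + f y)) - T (f x + f y)"
      using S[of "f x + f y" "x + y"] f[of x] f[of y]
        add_nonneg_nonneg[OF f(2)[of x] f(2)[of y]] by (simp add: ac_simps)
    also have "\<dots> = S x + S y"
      by (simp add: add f S_def)
    finally show "S (x + y) = S x + S y" .
  next
    fix x :: 'x assume "0 \<le> x"
    then have "S x = T x - T 0"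
      using S[of 0 x] by simp
    then show "S x = T x"
      using add[of 0 0] by simp
  qed
qed

section \<open>Maps commuting with idempotents: vanishing of the defect\<close>

locale idempotent_homogeneous_cone_map =
  X: directed_po_module scaleX + Y: directed_po_module scaleY
  for scaleX :: "'l::dedekind_complete_f_algebra_1 \<Rightarrow> 'x::ordered_ab_group_add \<Rightarrow> 'x"
    and scaleY :: "'l \<Rightarrow> 'y::ordered_ab_group_add \<Rightarrow> 'y" +
  fixes T :: "'x \<Rightarrow> 'y"
  assumes archimedean: "seq_almost_archimedean scaleY"
    and nonneg: "0 \<le> x \<Longrightarrow> 0 \<le> T x"
    and additive: "0 \<le> x \<Longrightarrow> 0 \<le> y \<Longrightarrow> T (x + y) = T x + T y"
    and idempotent: "p \<in> idempotents \<Longrightarrow> 0 \<le> x \<Longrightarrow> T (scaleX p x) = scaleY p (T x)"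
begin

lemma mono:
  assumes "0 \<le> x" "x \<le> y"
  shows "T x \<le> T y"
  using additive[of x "y - x"] nonneg[of "y - x"] assms by simp

definition defect :: "'x \<Rightarrow> 'l \<Rightarrow> 'y"
  where "defect x a = T (scaleX a x) - scaleY a (T x)"

lemma defect_add:
  assumes "0 \<le> x" "0 \<le> a" "0 \<le> b"
  shows "defect x (a + b) = defect x a + defect x b"
  using assms
  by (simp add: defect_def X.scale_left_distrib Y.scale_left_distrib additive X.scale_nonneg)

lemma defect_idempotent: "p \<in> idempotents \<Longrightarrow> 0 \<le> x \<Longrightarrow> defect x p = 0"
  by (simp add: defect_def idempotent)

text \<open>Both terms of the defect lie between \<open>0\<close> and \<open>T x\<close>.\<close>

lemma defect_bounds:
  assumes "0 \<le> x" "0 \<le> a" "a \<le> 1"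
  shows "- T x \<le> defect x a" "defect x a \<le> T x"
proof -
  have "scaleX a x \<le> x"
    using X.scale_right_mono[OF assms(3,1)] by (simp add: X.scale_one)
  then have T: "0 \<le> T (scaleX a x)" "T (scaleX a x) \<le> T x"
    using assms by (simp_all add: mono nonneg X.scale_nonneg)
  have s: "0 \<le> scaleY a (T x)" "scaleY a (T x) \<le> T x"
    using Y.scale_right_mono[OF assms(3) nonneg[OF assms(1)]] assms
    by (simp_all add: Y.scale_one Y.scale_nonneg nonneg)
  show "defect x a \<le> T x"
    using diff_mono[OF T(2) s(1)] by (simp add: defect_def)
  show "- T x \<le> defect x a"
    using diff_mono[OF T(1) s(2)] by (simp add: defect_def)
qed

text \<open>A binary expansion step: \<open>p\<close> acts as the leading digit of \<open>a\<close>
  and \<open>b\<close> as the shifted remainder; the digit has no defect.\<close>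

lemma defect_double:
  assumes "0 \<le> x" "0 \<le> a" "a \<le> 1"
  obtains b where "0 \<le> b" "b \<le> 1" "defect x b = defect x a + defect x a"
proof -
  obtain p where p: "p \<in> idempotents" "0 \<le> p * (a + a - 1)"
    and qa: "(1 - p) * (a + a - 1) \<le> 0"
    using ex_idempotent_carrier by blast
  have p01: "0 \<le> p" "p \<le> 1"
    using p(1) by (simp_all add: idempotent_nonneg idempotent_le_1)
  define b where "b = a + a - p"
  have pa: "0 \<le> p * a + p * a - p"
    using p(2) by (simp add: algebra_simps)
  have qa': "0 \<le> (1 - p) * a" and pa': "0 \<le> p * (1 - a)"
    using p01 assms by (simp_all add: mult_nonneg_nonneg)
  \<comment> \<open>On \<open>p\<close> the remainder is \<open>2a - 1\<close>, off \<open>p\<close>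
    it is \<open>2a\<close>.\<close>
  have "b = (p * a + p * a - p) + ((1 - p) * a + (1 - p) * a)"
    by (simp add: b_def algebra_simps)
  then have "0 \<le> b"
    using pa qa' by (simp add: add_nonneg_nonneg)
  \<comment> \<open>On \<open>p\<close> this is \<open>2(1 - a)\<close>, off \<open>p\<close> it is
    \<open>1 - 2a\<close>.\<close>
  have "1 - b = (p * (1 - a) + p * (1 - a)) + - ((1 - p) * (a + a - 1))"
    by (simp add: b_def algebra_simps)
  also have "0 \<le> \<dots>"
    using pa' qa by (intro add_nonneg_nonneg) simp_all
  finally have "b \<le> 1"
    by simp
  have "defect x (a + a) = defect x (p + b)"
    by (simp add: b_def)
  then have "defect x b = defect x a + defect x a"
    using assms p(1) p01 \<open>0 \<le> b\<close> by (simp add: defect_add defect_idempotent)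
  with \<open>0 \<le> b\<close> \<open>b \<le> 1\<close> show thesis
    by (rule that)
qed

lemma defect_eq_0_unit_interval:
  assumes "0 \<le> x" "0 \<le> a" "a \<le> 1"
  shows "defect x a = 0"
proof (rule seq_almost_archimedean_half_powers[OF _ archimedean nonneg[OF assms(1)]])
  \<comment> \<open>Each multiple by \<open>2 ^ k\<close> is again a defect on the unit interval, so
    one bound serves all \<open>k\<close>.\<close>
  have ex: "\<exists>b. 0 \<le> b \<and> b \<le> 1 \<and> defect x b = scaleY (2 ^ k *\<^sub>R 1) (defect x a)" for k
  proof (induction k)
    case 0
    then show ?case
      using assms by (auto simp: Y.scale_one)
  next
    case (Suc k)
    then obtain b where b: "0 \<le> b" "b \<le> 1" "defect x b = scaleY (2 ^ k *\<^sub>R 1) (defect x a)"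
      by blast
    obtain c where "0 \<le> c" "c \<le> 1" "defect x c = defect x b + defect x b"
      using defect_double[OF assms(1) b(1,2)] .
    moreover have "scaleY (2 ^ Suc k *\<^sub>R 1) (defect x a)
        = scaleY (2 ^ k *\<^sub>R 1) (defect x a) + scaleY (2 ^ k *\<^sub>R 1) (defect x a)"
      by (simp flip: Y.scale_left_distrib scaleR_left_distrib)
    ultimately show ?case
      using b(3) by auto
  qed
  show "- T x \<le> scaleY (2 ^ k *\<^sub>R 1) (defect x a)" for k
    using ex[of k] defect_bounds(1)[OF assms(1)] by metis
  show "scaleY (2 ^ k *\<^sub>R 1) (defect x a) \<le> T x" for k
    using ex[of k] defect_bounds(2)[OF assms(1)] by metis
qed unfold_locales

text \<open>Induction peels off \<open>inf a 1\<close>, which lies in the unit interval; the rest of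
  an element below \<open>n + 1\<close> is below \<open>n\<close>.\<close>

lemma defect_eq_0_bounded:
  assumes "0 \<le> x" "0 \<le> a" "a \<le> real n *\<^sub>R 1"
  shows "defect x a = 0"
  using assms(2,3)
proof (induction n arbitrary: a)
  case 0
  then have "a = 0"
    by (simp add: antisym)
  then show ?case
    using defect_eq_0_unit_interval[OF assms(1), of a] one_nonneg by simp
next
  case (Suc n)
  have "a \<le> 1 + real n *\<^sub>R 1"
    using Suc.prems(2) by (simp add: scaleR_left_distrib)
  moreover have "a \<le> a + real n *\<^sub>R 1"
    by (simp add: scaleR_nonneg_nonneg[OF of_nat_0_le_iff one_nonneg])
  ultimately have le: "a \<le> inf a 1 + real n *\<^sub>R 1"
    by (simp add: add_inf_distrib_right)
  define b where "b = inf a 1"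
  have b: "0 \<le> b" "b \<le> a" "b \<le> 1"
    using Suc.prems one_nonneg by (simp_all add: b_def)
  have "defect x (a - b) = 0"
    using b le by (intro Suc.IH) (simp_all add: b_def[symmetric] diff_le_eq add.commute)
  moreover have "defect x b = 0"
    using b by (intro defect_eq_0_unit_interval assms(1))
  moreover have "defect x (b + (a - b)) = defect x b + defect x (a - b)"
    using b by (intro defect_add assms(1)) simp_all
  ultimately show ?case
    by simp
qed

lemma defect_eq_0:
  assumes "0 \<le> x" "0 \<le> a"
  shows "defect x a = 0"
proof -
  define z where "z = T (scaleX a x) + scaleY a (T x)"
  have Tnn: "0 \<le> T (scaleX a x)" "0 \<le> scaleY a (T x)"
    using assms by (simp_all add: nonneg X.scale_nonneg Y.scale_nonneg)
  then have "0 \<le> z"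
    by (simp add: z_def)
  \<comment> \<open>A difference of two nonnegative elements lies between minus and plus their
    sum.\<close>
  have E: "- z \<le> defect x a" "defect x a \<le> z"
    using diff_mono[OF Tnn(1) order_refl[of "scaleY a (T x)"]]
      diff_mono[OF order_refl[of "T (scaleX a x)"] Tnn(2)] Tnn
    by (auto simp: defect_def z_def intro: order_trans add_increasing add_increasing2)
  have bounds: "- scaleY a z \<le> scaleY (2 ^ k *\<^sub>R 1) (defect x a) \<and>
      scaleY (2 ^ k *\<^sub>R 1) (defect x a) \<le> scaleY a z" for k
  proof -
    define c :: 'l where "c = 2 ^ k *\<^sub>R 1"
    have "0 \<le> c"
      by (simp add: c_def scaleR_nonneg_nonneg one_nonneg)
    obtain p where p: "p \<in> idempotents" "0 \<le> p * (a - c)"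
      and qa: "(1 - p) * (a - c) \<le> 0"
      using ex_idempotent_carrier by blast
    have p01: "0 \<le> p" "p \<le> 1"
      using p(1) by (simp_all add: idempotent_nonneg idempotent_le_1)
    have pa: "0 \<le> p * a" "0 \<le> (1 - p) * a"
      using p01 assms by (simp_all add: mult_nonneg_nonneg)
    \<comment> \<open>Off \<open>p\<close> the scalar is at most \<open>2 ^ k\<close>, so the
      bounded case removes that part of the defect.\<close>
    have "(1 - p) * a \<le> (1 - p) * c"
      using qa by (simp add: right_diff_distrib)
    also have "\<dots> \<le> c"
      using mult_right_mono[OF _ \<open>0 \<le> c\<close>, of "1 - p" 1] p01 by simp
    finally have "(1 - p) * a \<le> real (2 ^ k) *\<^sub>R 1"
      by (simp add: c_def)
    then have "defect x ((1 - p) * a) = 0"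
      by (rule defect_eq_0_bounded[OF assms(1) pa(2)])
    moreover have "defect x (p * a + (1 - p) * a) = defect x (p * a) + defect x ((1 - p) * a)"
      using assms(1) pa by (rule defect_add)
    moreover have "p * a + (1 - p) * a = a"
      by (simp add: algebra_simps)
    ultimately have "defect x a = defect x (p * a)"
      by simp
    also have "\<dots> = scaleY p (defect x a)"
      using assms p(1)
      by (simp add: defect_def idempotent X.scale_nonneg Y.scale_diff_right
          flip: X.scale_scale Y.scale_scale)
    \<comment> \<open>The unbounded scalars \<open>c\<close> are thereby replaced by
      \<open>c * p\<close>, which stay below \<open>a\<close> for every \<open>k\<close>.\<close>
    finally have "scaleY c (defect x a) = scaleY (c * p) (defect x a)"
      by (simp flip: Y.scale_scale)
    moreover have "c * p \<le> a"
    proof -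
      \<comment> \<open>Commutativity of the algebra is not assumed; \<open>c\<close> commutes as a
        real multiple of \<open>1\<close>.\<close>
      have "c * p = p * c"
        by (simp add: c_def)
      also have "\<dots> \<le> p * a"
        using p(2) by (simp add: right_diff_distrib)
      also have "\<dots> \<le> a"
        using pa(2) by (simp add: left_diff_distrib)
      finally show ?thesis .
    qed
    moreover have "0 \<le> c * p"
      using \<open>0 \<le> c\<close> p01 by simp
    ultimately show ?thesis
      using Y.scale_left_mono[OF E(1), of "c * p"] Y.scale_left_mono[OF E(2), of "c * p"]
        Y.scale_right_mono[OF _ \<open>0 \<le> z\<close>, of "c * p" a]
      by (simp add: c_def[symmetric] Y.scale_minus_right)
         (meson neg_le_iff_le order_trans)
  qed
  show ?thesis
    by (rule seq_almost_archimedean_half_powers[OF _ archimedean, of "scaleY a z"])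
       (use bounds assms \<open>0 \<le> z\<close> in \<open>auto intro: Y.scale_nonneg\<close>, unfold_locales)
qed

lemma homogeneous: "0 \<le> x \<Longrightarrow> 0 \<le> a \<Longrightarrow> T (scaleX a x) = scaleY a (T x)"
  using defect_eq_0[of x a] by (simp add: defect_def)

section \<open>Extension to the whole module and uniqueness\<close>

lemma nonneg_diff:
  obtains u v :: 'x where "0 \<le> u" "0 \<le> v" "x = u - v"
proof -
  obtain z where "x \<le> z" "0 \<le> z"
    using X.directed by blast
  then show thesis
    using that[of z "z - x"] by simp
qed

lemma ex1_positive_operator:
  "\<exists>!S. positive_operator scaleX scaleY S \<and> (\<forall>x\<in>{0..}. S x = T x)"
proof -
  obtain S where add: "\<And>x y. S (x + y) = S x + S y" and S: "\<And>x. 0 \<le> x \<Longrightarrow> S x = T x"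
    using additive_cone_extension[of T] X.directed additive by metis
  \<comment> \<open>Stated for any additive \<open>R\<close>, since it serves both \<open>S\<close>
    and a competing extension in the uniqueness part.\<close>
  have diff: "R (x - y) = R x - R y" if "\<And>x y. R (x + y) = R x + R y"
    for R :: "'x \<Rightarrow> 'y" and x y
    using that[of "x - y" y] by simp
  have pos: "S (scaleX a x) = scaleY a (S x)" if "0 \<le> a" for a and x :: 'x
  proof -
    obtain u v where "0 \<le> u" "0 \<le> v" "x = u - v"
      by (rule nonneg_diff[of x])
    then show ?thesis
      using that by (simp add: X.scale_diff_right Y.scale_diff_right diff[of S, OF add] S
          X.scale_nonneg homogeneous)
  qed
  have "S (scaleX a x) = scaleY a (S x)" for a x
  proof -
    \<comment> \<open>The positive and negative parts of \<open>a\<close> reduce the claim to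
      nonnegative scalars.\<close>
    obtain b c :: 'l where "0 \<le> b" "0 \<le> c" "a = b - c"
      by (rule that[OF _ _ pos_neg_parts(2)[of a]]) (rule sup.cobounded2)+
    then show ?thesis
      by (simp add: X.scale_diff_left Y.scale_diff_left diff[of S, OF add] pos)
  qed
  then have "positive_operator scaleX scaleY S"
    using add S nonneg by (auto simp: positive_operator_def po_module_hom_def)
  then show ?thesis
  proof (intro ex1I[of _ S] conjI ext)
    show "\<forall>x\<in>{0..}. S x = T x"
      by (simp add: S)
  next
    fix R
    assume R: "positive_operator scaleX scaleY R \<and> (\<forall>x\<in>{0..}. R x = T x)"
    fix x :: 'x
    obtain u v where "0 \<le> u" "0 \<le> v" "x = u - v"
      by (rule nonneg_diff[of x])
    moreover have "R (y + z) = R y + R z" for y z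
      using R by (simp add: positive_operator_def po_module_hom_def)
    ultimately show "R x = S x"
      using R by (simp add: diff[of R] diff[of S, OF add] S)
  qed
qed

end

theorem theorem4p2:
  fixes scaleX :: "'l::dedekind_complete_f_algebra_1 \<Rightarrow> 'x::ordered_ab_group_add \<Rightarrow> 'x"
    and scaleY :: "'l \<Rightarrow> 'y::ordered_ab_group_add \<Rightarrow> 'y"
    and T :: "'x \<Rightarrow> 'y"
  assumes "directed_po_module scaleX"
    and "directed_po_module scaleY"
    and "seq_almost_archimedean scaleY"
    and "T ` {0..} \<subseteq> {0..}"
    and "\<forall>x\<in>{0..}. \<forall>y\<in>{0..}. T (x + y) = T x + T y"
    and "\<forall>p\<in>idempotents. \<forall>x\<in>{0..}. T (scaleX p x) = scaleY p (T x)"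
  shows "\<exists>!S. positive_operator scaleX scaleY S \<and> (\<forall>x\<in>{0..}. S x = T x)"
proof -
  interpret X: directed_po_module scaleX by fact
  interpret Y: directed_po_module scaleY by fact
  interpret idempotent_homogeneous_cone_map scaleX scaleY T
    using assms(3-6) by unfold_locales (auto simp: image_subset_iff)
  show ?thesis
    by (rule ex1_positive_operator)
qed

end
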